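(* Let $\alpha$ be a composition with $\mathsf{sort}(\alpha)=1^{m_1}2^{m_2}\cdots j^{m_j}$, and let $\Phi$ be any set composition with $\rho(\Phi)=\alpha$. Then \[ P_\alpha=\sum_{\sigma\in\mathfrak S_{m_1}\times\cdots\times\mathfrak S_{m_j}}\rho(P_{\sigma(\Phi)}). \]
   Context: Notation: $\mathsf{sort}(\alpha)=1^{m_1}\cdots j^{m_j}$ means $\alpha$ has $m_i$ parts equal to $i$. For a set composition $\Phi=B_1|\cdots|B_l$ (disjoint nonempty blocks with union $[n]$), $\rho(\Phi)=(|B_1|,\dots,|B_l|)$. Action of $\sigma$: for $\sigma=(\sigma_1,\dots,\sigma_j)$, each $\sigma_i\in\mathfrak S_{m_i}$ permutes the blocks of size $i$ among the positions occupied by blocks of size $i$. That is, if the blocks of size $i$ are, from left to right, $C_1,\dots,C_{m_i}$, then in $\sigma(\Phi)$ the $r$-th block of size $i$ is $C_{\sigma_i^{-1}(r)}$. For example, $((2,3),(1,2))(4|25|7|13|6)=4|13|6|25|7$. QSym side: $x_1,x_2,\ldots$ are commuting variables, and $M_\gamma=\sum_{i_1<\dots<i_k}x_{i_1}^{c_1}\cdots x_{i_k}^{c_k}$ for $\gamma=(c_1,\dots,c_k)$. Fillings: a filling is a matrix with one nonzero entry per row; $\mathsf{col}$ lists the sums of the nonzero columns. $\mathsf{SD}(\alpha)$ for $\alpha=(a_1,\dots,a_k)$ is the set of fillings with $k$ rows, row $i$ having entry $a_i$, such that the following hold. - $a_1$ is in column 1. - $a_{i+1}$ is in the same column as $a_i$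 or the next column if $a_i\ge a_{i+1}$, and in the next column if $a_i<a_{i+1}$. - There are no empty columns. Row permutations: $\mathfrak S_{\mathsf F}$ consists of tuples $(\tau_1,\tau_2,\dots)$ where $\tau_i$ permutes the rows with entry $i$, and never sends a row to a different row whose entry lies in the same column. Then \[ P_\alpha=\sum_{\mathsf F\in\mathsf{SD}(\alpha),\tau\in\mathfrak S_{\mathsf F}}M_{\mathsf{col}(\tau(\mathsf F))}. \] NCQSym side: $x_w=x_{w_1}\cdots x_{w_n}$ in non-commuting variables. $\varrho(w)=B_1|\cdots|B_k$ with $B_r$ the set of positions holding the $r$-th smallest distinct value of $w$. $M_\Phi=\sum_{\varrho(w)=\Phi}x_w$. The map $\rho$ extends linearly to $\rho(M_\Phi)=M_{\rho(\Phi)}$. Order on blocks: $A>_{\mathcal D}B$ if $|A|>|B|$, or $|A|=|B|$ and $\min A<\min B$. LDD fillings: $\mathsf{LDD}(\Phi)$ is the set of placements of $B_i$ in row $i$ such that the following hold. - $B_1$ is in column 1. - $B_{i+1}$ is in the same or the next column as $B_i$ if $B_i>_{\mathcal D}B_{i+1}$, and in the next column otherwise. $\mathsf{col}$ lists the unions of the nonempty columns. Then $P_\Phi=\sum_{\tilde{\mathsf F}\in\mathsf{LDD}(\Phi)}M_{\mathsf{col}(\tilde{\mathsf F})}$.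
   Formalization: In P_α, for each F the sum runs over the distinct fillings τ(F), not over all tuples τ in S_F; counted by tuples the identity fails, e.g. for α=(1,1,1,1), where M_(2,2) would get coefficient 9 on the left but 6 on the right. *)

theory Defs
  imports
    Complex_Main
    "HOL-Library.Poly_Mapping"
    "HOL-Library.Function_Algebras"
    "HOL-Library.FuncSet"
    "HOL-Combinatorics.Permutations"
begin

section \<open>Compositions and set compositions\<close>

definition is_composition :: "nat list \<Rightarrow> bool" where
  "is_composition \<alpha> \<longleftrightarrow> (\<forall>a\<in>set \<alpha>. 0 < a)"

definition is_set_composition :: "nat \<Rightarrow> nat set list \<Rightarrow> bool" where
  "is_set_composition n \<Phi> \<longleftrightarrow>
     (\<forall>B\<in>set \<Phi>. B \<noteq> {}) \<and>
     (\<forall>r s. r < s \<and> s < length \<Phi> \<longrightarrow> \<Phi> ! r \<inter> \<Phi> ! s = {}) \<and>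
     \<Union>(set \<Phi>) = {1..n}"

definition block_sizes :: "nat set list \<Rightarrow> nat list" where
  "block_sizes \<Phi> = map card \<Phi>"

text \<open>
  The positions of a list are numbered from 0; the \<open>r\<close>-th block of size \<open>i\<close> has \<open>r\<close> counted from 1.
  The block at position \<open>p\<close> of the result is the one numbered \<open>\<sigma>\<^sub>i\<^sup>-\<^sup>1(r)\<close> among
  the blocks of size \<open>i\<close>, where position \<open>p\<close> holds the \<open>r\<close>-th block of size \<open>i\<close>.
\<close>

definition act :: "(nat \<Rightarrow> nat \<Rightarrow> nat) \<Rightarrow> nat set list \<Rightarrow> nat set list" where
  "act \<sigma> \<Phi> = map (\<lambda>p.
     let i = card (\<Phi> ! p);
         r = card {q. q \<le> p \<and> card (\<Phi> ! q) = i};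
         C = filter (\<lambda>B. card B = i) \<Phi>
     in C ! (inv (\<sigma> i) r - 1)) [0..<length \<Phi>]"


section \<open>Formal series\<close>

text \<open>
  A series in commuting variables \<open>x\<^sub>1, x\<^sub>2, \<dots>\<close> is given by its coefficients on the monomials, which
  are finitely supported exponent vectors; a series in non-commuting variables by its coefficients
  on words. Addition is pointwise. The index 0 is not used for a variable.
\<close>

type_synonym qseries = "(nat \<Rightarrow>\<^sub>0 nat) \<Rightarrow> rat"
type_synonym ncseries = "nat list \<Rightarrow> rat"

definition series_scale :: "rat \<Rightarrow> ('a \<Rightarrow> rat) \<Rightarrow> 'a \<Rightarrow> rat" where
  "series_scale c f = (\<lambda>x. c * f x)"

interpretation series: vector_space "series_scale :: rat \<Rightarrow> ('a \<Rightarrow> rat) \<Rightarrow> 'a \<Rightarrow> rat"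
  by unfold_locales (auto simp: series_scale_def algebra_simps)

interpretation nc_to_q: vector_space_pair
  "series_scale :: rat \<Rightarrow> ncseries \<Rightarrow> ncseries"
  "series_scale :: rat \<Rightarrow> qseries \<Rightarrow> qseries" ..

text \<open>For indices \<open>i\<^sub>1 < \<dots> < i\<^sub>k\<close>, the monomial with exponents \<open>\<gamma>\<close> on these variables.\<close>

definition index_monom :: "nat list \<Rightarrow> nat list \<Rightarrow> (nat \<Rightarrow>\<^sub>0 nat)" where
  "index_monom \<gamma> ks = (\<Sum>r<length \<gamma>. Poly_Mapping.single (ks ! r) (\<gamma> ! r))"

definition M_comp :: "nat list \<Rightarrow> qseries" where
  "M_comp \<gamma> = (\<lambda>e. of_nat (card {ks. length ks = length \<gamma> \<and> sorted_wrt (<) ks \<and> 0 \<notin> set ks \<and>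
                                    index_monom \<gamma> ks = e}))"

definition word_blocks :: "nat list \<Rightarrow> nat set list" where
  "word_blocks w = map (\<lambda>v. {Suc p |p. p < length w \<and> w ! p = v}) (sorted_list_of_set (set w))"

definition M_setcomp :: "nat set list \<Rightarrow> ncseries" where
  "M_setcomp \<Phi> = (\<lambda>w. of_bool (0 \<notin> set w \<and> word_blocks w = \<Phi>))"

definition set_compositions :: "nat set list set" where
  "set_compositions = {\<Phi>. \<exists>n. is_set_composition n \<Phi>}"

text \<open>
  The linear extension of \<open>M\<^sub>\<Phi> \<mapsto> M\<^sub>\<gamma>\<close>, \<open>\<gamma>\<close> being the block sizes of \<open>\<Phi>\<close>. The
  values of \<open>construct\<close> outside the span of the \<open>M\<^sub>\<Phi>\<close> are irrelevant.
\<close>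

definition rho :: "ncseries \<Rightarrow> qseries" where
  "rho = nc_to_q.construct (M_setcomp ` set_compositions)
           (\<lambda>f. M_comp (block_sizes (inv_into set_compositions M_setcomp f)))"


section \<open>Fillings\<close>

text \<open>
  A filling, having one entry in each row, is the list of its rows, each given by its entry
  and the column of this entry. Rows are numbered from 0 (as list positions), columns from 1.
\<close>

type_synonym 'e filling = "('e \<times> nat) list"

definition columns :: "'e filling \<Rightarrow> nat list" where
  "columns F = sorted_list_of_set (snd ` set F)"

definition col :: "nat filling \<Rightarrow> nat list" where
  "col F = map (\<lambda>c. \<Sum>r | r < length F \<and> snd (F ! r) = c. fst (F ! r)) (columns F)"

definition col_set :: "nat set filling \<Rightarrow> nat set list" where
  "col_set F = map (\<lambda>c. \<Union>{B. (B, c) \<in> set F}) (columns F)"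

text \<open>The column rule common to both kinds of filling: staying in a column requires \<open>R\<close>.\<close>

definition diagonal :: "('e \<Rightarrow> 'e \<Rightarrow> bool) \<Rightarrow> 'e filling \<Rightarrow> bool" where
  "diagonal R F \<longleftrightarrow>
     (F \<noteq> [] \<longrightarrow> snd (F ! 0) = 1) \<and>
     (\<forall>r. Suc r < length F \<longrightarrow>
        (if R (fst (F ! r)) (fst (F ! Suc r))
         then snd (F ! Suc r) = snd (F ! r) \<or> snd (F ! Suc r) = Suc (snd (F ! r))
         else snd (F ! Suc r) = Suc (snd (F ! r))))"

definition SD :: "nat list \<Rightarrow> nat filling set" where
  "SD \<alpha> = {F. map fst F = \<alpha> \<and> diagonal (\<ge>) F \<and> (\<exists>c. snd ` set F = {1..c})}"

definition block_greater :: "nat set \<Rightarrow> nat set \<Rightarrow> bool" where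
  "block_greater A B \<longleftrightarrow> card A > card B \<or> (card A = card B \<and> Min A < Min B)"

definition LDD :: "nat set list \<Rightarrow> nat set filling set" where
  "LDD \<Phi> = {F. map fst F = \<Phi> \<and> diagonal block_greater F}"

definition rows_with :: "nat filling \<Rightarrow> nat \<Rightarrow> nat set" where
  "rows_with F i = {r. r < length F \<and> fst (F ! r) = i}"

definition row_perms :: "nat filling \<Rightarrow> (nat \<Rightarrow> nat \<Rightarrow> nat) set" where
  "row_perms F = {\<tau>. \<forall>i. \<tau> i permutes rows_with F i \<and>
     (\<forall>r\<in>rows_with F i. \<tau> i r \<noteq> r \<longrightarrow> snd (F ! \<tau> i r) \<noteq> snd (F ! r))}"

text \<open>Row \<open>r\<close> of \<open>F\<close>, with entry \<open>i\<close>, becomes row \<open>\<tau>\<^sub>i(r)\<close>.\<close>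

definition permute_rows :: "(nat \<Rightarrow> nat \<Rightarrow> nat) \<Rightarrow> nat filling \<Rightarrow> nat filling" where
  "permute_rows \<tau> F = map (\<lambda>r. F ! inv (\<tau> (fst (F ! r))) r) [0..<length F]"


section \<open>The power sums\<close>

text \<open>
  The sum over \<open>F\<close> and \<open>\<tau>\<close> is read as a sum over the fillings \<open>\<tau>(F)\<close>: two tuples which
  produce the same filling from \<open>F\<close> contribute one term. With one term for each tuple,
  \<open>P\<close> at \<open>(1,1,1,1)\<close> would have the coefficient 9 at \<open>M\<close> of \<open>(2,2)\<close>, as
  four tuples exchange the rows of the first column with those of the second. That coefficient
  has to be 6, because \<open>P\<close> at \<open>(1,1,1,1)\<close> is the fourth power of \<open>x\<^sub>1 + x\<^sub>2 + \<dots>\<close>.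
\<close>

definition P_comp :: "nat list \<Rightarrow> qseries" where
  "P_comp \<alpha> = (\<Sum>F\<in>SD \<alpha>. \<Sum>G\<in>(\<lambda>\<tau>. permute_rows \<tau> F) ` row_perms F. M_comp (col G))"

definition P_setcomp :: "nat set list \<Rightarrow> ncseries" where
  "P_setcomp \<Phi> = (\<Sum>F\<in>LDD \<Phi>. M_setcomp (col_set F))"


section \<open>The definitions are not degenerate\<close>

lemma diagonal_column_le:
  assumes "diagonal R F" "r < length F"
  shows "snd (F ! r) \<le> Suc r"
  using assms(2)
proof (induction r)
  case 0
  then have "F \<noteq> []" by auto
  then have "snd (F ! 0) = 1" using assms(1) unfolding diagonal_def by blast
  then show ?case by simp
next
  case (Suc r)
  have "snd (F ! Suc r) = snd (F ! r) \<or> snd (F ! Suc r) = Suc (snd (F ! r))"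
    using assms(1) Suc.prems unfolding diagonal_def by meson
  moreover have "snd (F ! r) \<le> Suc r" using Suc by simp
  ultimately show ?case by linarith
qed

lemma finite_diagonal: "finite {F. map fst F = xs \<and> diagonal R F}"
proof (rule finite_subset)
  show "{F. map fst F = xs \<and> diagonal R F} \<subseteq>
          {F. set F \<subseteq> set xs \<times> {..length xs} \<and> length F = length xs}"
  proof safe
    fix F a c assume F: "diagonal R F" "xs = map fst F" "(a, c) \<in> set F"
    then obtain r where r: "r < length F" "F ! r = (a, c)" by (auto simp: in_set_conv_nth)
    show "c \<le> length (map fst F)" using diagonal_column_le[OF F(1) r(1)] r by simp
    show "a \<in> set (map fst F)" using image_eqI[of a fst "(a, c)" "set F"] F(3) by simp
  qed simp
qed (rule finite_lists_length_eq, simp)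

lemma finite_SD: "finite (SD \<alpha>)"
  by (rule finite_subset[OF _ finite_diagonal[of \<alpha> "(\<ge>)"]]) (auto simp: SD_def)

lemma finite_LDD: "finite (LDD \<Phi>)"
  unfolding LDD_def by (rule finite_diagonal)

lemma finite_row_fillings: "finite ((\<lambda>\<tau>. permute_rows \<tau> F) ` row_perms F)"
proof (rule finite_subset)
  show "(\<lambda>\<tau>. permute_rows \<tau> F) ` row_perms F \<subseteq> {G. set G \<subseteq> set F \<and> length G = length F}"
  proof safe
    fix \<tau> a c assume t: "\<tau> \<in> row_perms F" "(a, c) \<in> set (permute_rows \<tau> F)"
    then obtain r where r: "r < length F" "(a, c) = F ! inv (\<tau> (fst (F ! r))) r"
      by (auto simp: permute_rows_def)
    have "inv (\<tau> (fst (F ! r))) permutes rows_with F (fst (F ! r))"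
      using t(1) by (auto simp: row_perms_def intro: permutes_inv)
    then have "inv (\<tau> (fst (F ! r))) r \<in> rows_with F (fst (F ! r))"
      using r(1) by (subst permutes_in_image) (auto simp: rows_with_def)
    then have "inv (\<tau> (fst (F ! r))) r < length F" by (simp only: rows_with_def mem_Collect_eq)
    then show "(a, c) \<in> set F" unfolding r(2) by (rule nth_mem)
  qed (simp add: permute_rows_def)
qed (rule finite_lists_length_eq, simp)

lemma ex_word_of_set_composition:
  assumes "is_set_composition n \<Phi>"
  shows "\<exists>w. 0 \<notin> set w \<and> word_blocks w = \<Phi>"
proof -
  have disj: "\<Phi> ! r \<inter> \<Phi> ! s = {}" if "r \<noteq> s" "r < length \<Phi>" "s < length \<Phi>" for r s
    using assms that unfolding is_set_composition_def
    by (metis Int_commute linorder_neqE_nat)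
  have "\<exists>r<length \<Phi>. x \<in> \<Phi> ! r" if "x \<in> {1..n}" for x
    using assms that unfolding is_set_composition_def by (metis UnionE in_set_conv_nth)
  then obtain b where b: "\<And>x. x \<in> {1..n} \<Longrightarrow> b x < length \<Phi> \<and> x \<in> \<Phi> ! b x" by metis
  have sub: "\<Phi> ! r \<subseteq> {1..n}" if "r < length \<Phi>" for r
    using assms that unfolding is_set_composition_def by (metis Union_upper nth_mem)
  have uniq: "b x = r" if "r < length \<Phi>" "x \<in> \<Phi> ! r" for x r
    using disj[of r "b x"] b[of x] sub that by blast
  define w where "w = map (\<lambda>p. Suc (b (Suc p))) [0..<n]"
  have set_w: "set w = {1..<Suc (length \<Phi>)}"
  proof (intro equalityI subsetI)
    fix v assume "v \<in> set w" then show "v \<in> {1..<Suc (length \<Phi>)}" using b by (auto simp: w_def)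
  next
    fix v assume v: "v \<in> {1..<Suc (length \<Phi>)}"
    then have r: "v - 1 < length \<Phi>" by auto
    then obtain x where x: "x \<in> \<Phi> ! (v - 1)"
      using assms unfolding is_set_composition_def by (metis ex_in_conv nth_mem)
    have "x \<in> {1..n}" "b x = v - 1" using sub[OF r] x uniq[OF r x] by auto
    then have "x - 1 \<in> {0..<n}" "v = Suc (b (Suc (x - 1)))" using v by auto
    then show "v \<in> set w" by (auto simp: w_def)
  qed
  have "{Suc p |p. p < length w \<and> w ! p = Suc r} = \<Phi> ! r" if r: "r < length \<Phi>" for r
  proof (intro equalityI subsetI)
    fix x assume "x \<in> {Suc p |p. p < length w \<and> w ! p = Suc r}"
    then show "x \<in> \<Phi> ! r" using b[of x] by (auto simp: w_def)
  next
    fix x assume x: "x \<in> \<Phi> ! r"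
    then have "x \<in> {1..n}" "b x = r" using sub[OF r] uniq[OF r x] by auto
    then have "x = Suc (x - 1)" "x - 1 < length w" "w ! (x - 1) = Suc r" by (auto simp: w_def)
    then show "x \<in> {Suc p |p. p < length w \<and> w ! p = Suc r}" by blast
  qed
  then have "word_blocks w = \<Phi>"
    unfolding word_blocks_def set_w sorted_list_of_set_range
    by (intro nth_equalityI) (simp_all del: upt_Suc)
  moreover have "0 \<notin> set w" by (auto simp: w_def)
  ultimately show ?thesis by blast
qed

lemma set_composition_word:
  assumes "\<Phi> \<in> set_compositions"
  obtains w where "\<And>\<Psi>. M_setcomp \<Psi> w = of_bool (\<Psi> = \<Phi>)"
proof -
  obtain w where "0 \<notin> set w" "word_blocks w = \<Phi>"
    using assms ex_word_of_set_composition by (auto simp: set_compositions_def)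
  then have "M_setcomp \<Psi> w = of_bool (\<Psi> = \<Phi>)" for \<Psi> by (auto simp: M_setcomp_def)
  with that show thesis by blast
qed

lemma inj_on_M_setcomp: "inj_on M_setcomp set_compositions"
proof (rule inj_onI)
  fix \<Phi> \<Psi> assume "\<Phi> \<in> set_compositions" and eq: "M_setcomp \<Phi> = M_setcomp \<Psi>"
  then obtain w where w: "\<And>\<Psi>. M_setcomp \<Psi> w = of_bool (\<Psi> = \<Phi>)"
    using set_composition_word by blast
  have "of_bool (\<Psi> = \<Phi>) = (of_bool (\<Phi> = \<Phi>) :: rat)" unfolding w[symmetric] eq by (rule refl)
  then show "\<Phi> = \<Psi>" by (simp split: if_splits)
qed

lemma sum_fun_apply: "(\<Sum>x\<in>A. f x) y = (\<Sum>x\<in>A. f x y)"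
  for f :: "'a \<Rightarrow> 'b \<Rightarrow> 'c::comm_monoid_add"
  by (induction A rule: infinite_finite_induct) auto

lemma independent_M_setcomp: "series.independent (M_setcomp ` set_compositions)"
  unfolding series.dependent_explicit
proof safe
  fix T u f
  assume T: "finite T" "T \<subseteq> M_setcomp ` set_compositions"
    and z: "(\<Sum>v\<in>T. series_scale (u v) v) = 0" and f: "f \<in> T" "u f \<noteq> 0"
  obtain \<Phi> where \<Phi>: "\<Phi> \<in> set_compositions" "f = M_setcomp \<Phi>" using T f by blast
  then obtain w where w: "\<And>\<Psi>. M_setcomp \<Psi> w = of_bool (\<Psi> = \<Phi>)"
    using set_composition_word by blast
  have fw: "v w = of_bool (v = f)" if v: "v \<in> T" for v
  proof -
    obtain \<Psi> where \<Psi>: "\<Psi> \<in> set_compositions" "v = M_setcomp \<Psi>" using v T(2) by blast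
    have "(v = f) = (\<Psi> = \<Phi>)"
      unfolding \<Psi>(2) \<Phi>(2) by (rule inj_on_eq_iff[OF inj_on_M_setcomp \<Psi>(1) \<Phi>(1)])
    then show ?thesis unfolding \<Psi>(2) by (simp only: w)
  qed
  have "0 = (\<Sum>v\<in>T. series_scale (u v) v) w" unfolding z by simp
  also have "\<dots> = (\<Sum>v\<in>T. if v = f then u f else 0)"
    unfolding sum_fun_apply by (rule sum.cong) (auto simp: series_scale_def fw)
  also have "\<dots> = u f" using T(1) f(1) by simp
  finally show False using f(2) by simp
qed

lemma linear_rho: "Vector_Spaces.linear series_scale series_scale rho"
  unfolding rho_def by (rule nc_to_q.linear_construct[OF independent_M_setcomp])

lemma rho_M_setcomp:
  assumes "is_set_composition n \<Phi>"
  shows "rho (M_setcomp \<Phi>) = M_comp (block_sizes \<Phi>)"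
proof -
  have \<Phi>: "\<Phi> \<in> set_compositions" using assms by (auto simp: set_compositions_def)
  show ?thesis unfolding rho_def
    by (subst nc_to_q.construct_basis[OF independent_M_setcomp])
       (use \<Phi> in \<open>simp_all add: inv_into_f_f[OF inj_on_M_setcomp]\<close>)
qed

end

theory Submission
  imports Defs "HOL-Library.Product_Lexorder"
begin

text \<open>
  The fillings \<open>\<tau>(F)\<close> are exactly the rearrangements of the multiset of rows of \<open>F\<close> having
  the same sequence of entries, and the \<open>\<sigma>(\<Phi>)\<close> are, without repetition, the rearrangements of
  \<open>\<Phi>\<close> having the same sequence of block sizes. Attaching to each block of \<open>\<Phi>\<close> a column turns both
  sides into a sum over such attachments: a filling \<open>G = \<tau>(F)\<close> is the attachment read in the order of
  \<open>\<Phi>\<close>, and a filling in \<open>LDD\<close> is the same attachment sorted by column, then by decreasing size,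
  then by increasing minimum. As sorting is unique, \<open>F\<close> and the filling in \<open>LDD\<close> are both
  determined by \<open>G\<close>.
\<close>

section \<open>Row permutations\<close>

text \<open>The rows split by entry, and each \<open>\<tau> i\<close> acts on one class. The
  inverses glue to a single permutation \<open>\<pi>\<close> of all row positions, and
  \<open>\<pi>\<close> preserves entries.\<close>

lemma permute_rows_rearranges:
  assumes "\<tau> \<in> row_perms F"
  shows "map fst (permute_rows \<tau> F) = map fst F" "mset (permute_rows \<tau> F) = mset F"
proof -
  define \<pi> where "\<pi> r = (if r < length F then inv (\<tau> (fst (F ! r))) r else r)" for r
  have perm: "inv (\<tau> i) permutes rows_with F i" for i
    using assms by (auto simp: row_perms_def intro: permutes_inv)
  have row: "\<pi> r < length F \<and> fst (F ! \<pi> r) = fst (F ! r)" if "r < length F" for r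
  proof -
    have "\<pi> r \<in> rows_with F (fst (F ! r))"
      using permutes_in_image[OF perm[of "fst (F ! r)"], of r] that by (simp add: \<pi>_def rows_with_def)
    then show ?thesis by (simp add: rows_with_def)
  qed
  have "inj_on \<pi> {..<length F}"
  proof (rule inj_onI)
    fix r s assume rs: "r \<in> {..<length F}" "s \<in> {..<length F}" "\<pi> r = \<pi> s"
    then have i: "fst (F ! r) = fst (F ! s)" using row by (metis lessThan_iff)
    then have "inv (\<tau> (fst (F ! s))) r = inv (\<tau> (fst (F ! s))) s" using rs by (simp add: \<pi>_def)
    then show "r = s" using permutes_inj[OF perm] by (metis injD)
  qed
  moreover have "\<pi> ` {..<length F} \<subseteq> {..<length F}" using row by auto
  ultimately have "bij_betw \<pi> {..<length F} {..<length F}" by (simp add: bij_betw_def endo_inj_surj)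
  then have \<pi>: "\<pi> permutes {..<length F}" by (rule bij_imp_permutes) (simp add: \<pi>_def)
  have eq: "permute_rows \<tau> F = permute_list \<pi> F"
    by (simp add: permute_rows_def permute_list_def \<pi>_def)
  show "mset (permute_rows \<tau> F) = mset F" unfolding eq using \<pi> by simp
  show "map fst (permute_rows \<tau> F) = map fst F"
    unfolding eq by (rule nth_equalityI) (auto simp: permute_list_def row)
qed

text \<open>Rows on which \<open>F\<close> and \<open>G\<close> agree are fixed; this is what makes the
  permutation move every other row to a different column.\<close>

lemma ex_row_perm:
  assumes fst_eq: "map fst G = map fst F" and mset_eq: "mset G = mset F"
  shows "\<exists>\<tau>\<in>row_perms F. permute_rows \<tau> F = G"
proof -
  let ?N = "length F"
  have len: "length G = ?N" using mset_eq by (metis size_mset)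
  have fst_nth: "fst (G ! r) = fst (F ! r)" if "r < ?N" for r
    using fst_eq that len by (metis nth_map)
  \<comment> \<open>\<open>A x\<close> collects the positions that a row \<open>x\<close> has to
    leave, \<open>B x\<close> those it has to enter, in passing from \<open>F\<close> to
    \<open>G\<close>. Removing the common positions from the occurrences of \<open>x\<close> in both
    lists leaves sets of equal size.\<close>
  define A where "A x = {r. r < ?N \<and> F ! r = x \<and> G ! r \<noteq> x}" for x
  define B where "B x = {r. r < ?N \<and> G ! r = x \<and> F ! r \<noteq> x}" for x
  have "card (A x) = card (B x)" for x
  proof -
    let ?C = "{r. r < ?N \<and> F ! r = x \<and> G ! r = x}"
    have count: "card {r. r < length H \<and> H ! r = x} = count (mset H) x" for H :: "nat filling"
      unfolding count_mset count_list_eq_length_filter length_filter_conv_card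
      by (rule arg_cong[where f = card]) auto
    have "card {r. r < ?N \<and> F ! r = x} = card {r. r < ?N \<and> G ! r = x}"
      using count[of F] count[of G] mset_eq len by simp
    moreover have "{r. r < ?N \<and> F ! r = x} = A x \<union> ?C" "{r. r < ?N \<and> G ! r = x} = B x \<union> ?C"
      by (auto simp: A_def B_def)
    moreover have "card (A x \<union> ?C) = card (A x) + card ?C" "card (B x \<union> ?C) = card (B x) + card ?C"
      by (rule card_Un_disjoint; auto simp: A_def B_def)+
    ultimately show ?thesis by simp
  qed
  then have "\<exists>h. bij_betw h (A x) (B x)" for x
    by (intro finite_same_card_bij) (auto simp: A_def B_def)
  then obtain h where h: "\<And>x. bij_betw (h x) (A x) (B x)" by metis
  \<comment> \<open>Each row of \<open>F\<close> goes to a position where \<open>G\<close> holds it: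
    its own position if the two agree there, otherwise the one chosen by \<open>h\<close>.\<close>
  define t where "t r = (if r < ?N \<and> F ! r \<noteq> G ! r then h (F ! r) r else r)" for r
  have tB: "t r \<in> B (F ! r)" if "r < ?N" "F ! r \<noteq> G ! r" for r
    using bij_betwE[OF h[of "F ! r"]] that by (auto simp: A_def t_def)
  have t: "t r < ?N" "G ! t r = F ! r" if "r < ?N" for r
    using tB[OF that] that by (cases "F ! r = G ! r"; auto simp: B_def t_def)+
  have t_out: "t r = r" if "\<not> r < ?N" for r using that by (simp add: t_def)
  have t_inj: "inj_on t {..<?N}"
  proof (rule inj_onI)
    fix r s assume rs: "r \<in> {..<?N}" "s \<in> {..<?N}" "t r = t s"
    then have x: "F ! r = F ! s" using t(2) by (metis lessThan_iff)
    \<comment> \<open>A moved row lands where \<open>F\<close> does not hold it, a fixed row stays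
      where \<open>F\<close> holds it. Hence \<open>r\<close> and \<open>s\<close>, with equal rows
      and one image, are both fixed or both moved.\<close>
    show "r = s"
    proof (cases "F ! r = G ! r \<or> F ! s = G ! s")
      case True
      have "F ! t q = F ! q \<longleftrightarrow> F ! q = G ! q" if "q < ?N" for q
        using tB[of q] that by (auto simp: t_def B_def)
      then have "F ! r = G ! r" "F ! s = G ! s" using True rs x by (metis lessThan_iff)+
      then show ?thesis using rs by (simp add: t_def)
    next
      case False
      then have "h (F ! r) r = h (F ! r) s" "r \<in> A (F ! r)" "s \<in> A (F ! r)"
        using rs x by (auto simp: t_def A_def)
      then show ?thesis using bij_betw_imp_inj_on[OF h] by (metis inj_onD)
    qed
  qed
  have t_fst: "fst (F ! t r) = fst (F ! r)" if "r < ?N" for r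
    using fst_nth[OF t(1)[OF that]] t(2)[OF that] by simp
  define \<tau> where "\<tau> i r = (if r \<in> rows_with F i then t r else r)" for i r
  have perm: "\<tau> i permutes rows_with F i" for i
  proof (rule bij_imp_permutes)
    have "\<tau> i ` rows_with F i \<subseteq> rows_with F i" using t t_fst by (auto simp: \<tau>_def rows_with_def)
    moreover have "inj_on (\<tau> i) (rows_with F i)"
      using t_inj by (auto simp: \<tau>_def rows_with_def inj_on_def)
    moreover have "finite (rows_with F i)" by (simp add: rows_with_def)
    ultimately show "bij_betw (\<tau> i) (rows_with F i) (rows_with F i)"
      by (simp add: bij_betw_def endo_inj_surj)
  qed (simp add: \<tau>_def)
  have "snd (F ! \<tau> i r) \<noteq> snd (F ! r)" if "r \<in> rows_with F i" "\<tau> i r \<noteq> r" for i r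
  proof -
    have r: "r < ?N" "t r \<noteq> r" "\<tau> i r = t r" using that by (auto simp: \<tau>_def rows_with_def)
    then have "F ! t r \<noteq> F ! r" using tB[of r] by (auto simp: t_def B_def split: if_splits)
    then show ?thesis using t_fst[OF r(1)] r(3) by (simp add: prod_eq_iff)
  qed
  then have "\<tau> \<in> row_perms F" using perm by (auto simp: row_perms_def)
  moreover have "permute_rows \<tau> F = G"
  proof (rule nth_equalityI)
    fix r assume "r < length (permute_rows \<tau> F)"
    then have r: "r < ?N" by (simp add: permute_rows_def)
    let ?i = "fst (F ! r)"
    let ?s = "inv (\<tau> ?i) r"
    have "?s \<in> rows_with F ?i"
      using permutes_in_image[OF permutes_inv[OF perm[of ?i]], of r] r by (simp add: rows_with_def)
    then have s: "?s < ?N" "t ?s = \<tau> ?i ?s" by (auto simp: rows_with_def \<tau>_def)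
    then have "t ?s = r" using permutes_inverses(1)[OF perm] by simp
    then have "F ! ?s = G ! r" using t(2)[OF s(1)] by simp
    then show "permute_rows \<tau> F ! r = G ! r" using r by (simp add: permute_rows_def)
  qed (simp add: permute_rows_def len)
  ultimately show ?thesis by blast
qed

text \<open>The rule against moves within a column loses no filling: rows with equal entry and equal
  column are equal, so exchanging them changes nothing.\<close>

lemma permute_rows_image:
  "(\<lambda>\<tau>. permute_rows \<tau> F) ` row_perms F = {G. map fst G = map fst F \<and> mset G = mset F}"
proof (intro equalityI subsetI)
  fix G assume "G \<in> (\<lambda>\<tau>. permute_rows \<tau> F) ` row_perms F"
  then show "G \<in> {G. map fst G = map fst F \<and> mset G = mset F}"
    using permute_rows_rearranges by blast
next
  fix G assume "G \<in> {G. map fst G = map fst F \<and> mset G = mset F}"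
  then show "G \<in> (\<lambda>\<tau>. permute_rows \<tau> F) ` row_perms F"
    using ex_row_perm[of G F] by blast
qed

section \<open>Diagonal fillings are sorted\<close>

lemma diagonal_step:
  assumes "diagonal R F" "Suc r < length F"
  shows "snd (F ! Suc r) = Suc (snd (F ! r)) \<or>
    snd (F ! Suc r) = snd (F ! r) \<and> R (fst (F ! r)) (fst (F ! Suc r))"
  using assms unfolding diagonal_def by meson

lemma diagonalI:
  assumes "F \<noteq> [] \<Longrightarrow> snd (F ! 0) = 1"
    and "\<And>r. Suc r < length F \<Longrightarrow> snd (F ! Suc r) = Suc (snd (F ! r)) \<or>
      snd (F ! Suc r) = snd (F ! r) \<and> R (fst (F ! r)) (fst (F ! Suc r))"
  shows "diagonal R F"
  unfolding diagonal_def using assms by (simp split: if_splits) blast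

text \<open>Columns start at 1 and rise by at most one per row. This supplies the absence of empty
  columns when a filling in \<open>LDD\<close> is turned into one in \<open>SD\<close>.\<close>

lemma diagonal_columns_interval:
  assumes "diagonal R F"
  shows "\<exists>c. snd ` set F = {1..c}"
proof -
  \<comment> \<open>The induction over prefixes records the upper end as the column of the last row;
    the value 0 makes the interval empty for the empty prefix.\<close>
  have "snd ` set (take k F) = {1..if k = 0 then 0 else snd (F ! (k - 1))}" if "k \<le> length F" for k
    using that
  proof (induction k)
    case (Suc k)
    then have k: "k < length F" by simp
    have 1: "snd (F ! 0) = 1" using assms k unfolding diagonal_def by (cases F) auto
    have IH: "snd ` set (take k F) = {1..if k = 0 then 0 else snd (F ! (k - 1))}" using Suc by simp
    have step: "snd ` set (take (Suc k) F) = insert (snd (F ! k)) (snd ` set (take k F))"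
      using k by (simp add: take_Suc_conv_app_nth)
    show ?case
    proof (cases k)
      case 0
      then show ?thesis using 1 step by simp
    next
      case (Suc l)
      have "snd (F ! Suc l) = Suc (snd (F ! l)) \<or> snd (F ! Suc l) = snd (F ! l)"
        using diagonal_step[OF assms, of l] k Suc by auto
      moreover have "F ! l \<in> set (take k F)" using Suc k by (auto simp: in_set_conv_nth)
      then have "snd (F ! l) \<in> {1..snd (F ! l)}" using IH Suc by auto
      ultimately show ?thesis unfolding step IH using Suc by auto
    qed
  qed simp
  from this[of "length F"] show ?thesis by auto
qed

section \<open>Lexicographic keys for the two kinds of filling\<close>

definition size_key :: "nat \<times> nat \<Rightarrow> nat \<times> int" where
  "size_key = (\<lambda>(a, c). (c, - int a))"

text \<open>As in \<open>size_key\<close>, the negation in \<open>int\<close> makes decreasing size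
  an increasing key; the minimum breaks ties in the direction of
  \<open>block_greater\<close>.\<close>

definition block_key :: "nat set \<times> nat \<Rightarrow> nat \<times> int \<times> nat" where
  "block_key = (\<lambda>(B, c). (c, - int (card B), Min B))"

lemma inj_size_key: "inj size_key"
  by (auto simp: inj_def size_key_def)

lemma sorted_size_key:
  assumes "diagonal (\<ge>) F"
  shows "sorted (map size_key F)"
  unfolding sorted_iff_nth_Suc
proof (intro allI impI)
  fix r assume "Suc r < length (map size_key F)"
  then show "map size_key F ! r \<le> map size_key F ! Suc r"
    using diagonal_step[OF assms, of r] by (auto simp: size_key_def case_prod_beta less_eq_prod_def)
qed

lemma sorted_block_key:
  assumes "diagonal block_greater F"
  shows "sorted (map block_key F)"
  unfolding sorted_iff_nth_Suc
proof (intro allI impI)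
  fix r assume "Suc r < length (map block_key F)"
  then show "map block_key F ! r \<le> map block_key F ! Suc r"
    using diagonal_step[OF assms, of r]
    by (auto simp: block_key_def block_greater_def case_prod_beta less_eq_prod_def)
qed

text \<open>Dropping the last component of a lexicographic key only coarsens the order.\<close>

lemma sorted_size_key_of_block_key:
  assumes "sorted (map block_key F)"
  shows "sorted (map size_key (map (map_prod card id) F))"
  using assms unfolding sorted_iff_nth_Suc
  by (fastforce simp: size_key_def block_key_def case_prod_beta less_eq_prod_def)

lemma diagonal_sizes:
  assumes "diagonal block_greater F"
  shows "diagonal (\<ge>) (map (map_prod card id) F)"
proof (rule diagonalI)
  assume "map (map_prod card id) F \<noteq> []"
  then show "snd (map (map_prod card id) F ! 0) = 1"
    using assms by (cases F) (auto simp: diagonal_def)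
next
  fix r assume "Suc r < length (map (map_prod card id) F)"
  then show "snd (map (map_prod card id) F ! Suc r) = Suc (snd (map (map_prod card id) F ! r)) \<or>
      snd (map (map_prod card id) F ! Suc r) = snd (map (map_prod card id) F ! r) \<and>
      fst (map (map_prod card id) F ! Suc r) \<le> fst (map (map_prod card id) F ! r)"
    using diagonal_step[OF assms, of r] by (auto simp: block_greater_def)
qed

text \<open>The sizes control how the columns advance. Within a column, sorted keys order blocks of
  equal size by minimum, and distinct minima make this strict, as \<open>block_greater\<close>
  requires.\<close>

lemma diagonal_of_sorted_block_key:
  assumes sizes: "diagonal (\<ge>) (map (map_prod card id) F)"
    and sorted: "sorted (map block_key F)"
    and Min: "distinct (map (Min \<circ> fst) F)"
  shows "diagonal block_greater F"
proof (rule diagonalI)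
  assume "F \<noteq> []"
  then show "snd (F ! 0) = 1" using sizes by (cases F) (auto simp: diagonal_def)
next
  fix r assume r: "Suc r < length F"
  have "block_key (F ! r) \<le> block_key (F ! Suc r)"
    using sorted r unfolding sorted_iff_nth_Suc by simp
  moreover have "Min (fst (F ! r)) \<noteq> Min (fst (F ! Suc r))"
    using nth_eq_iff_index_eq[OF Min, of r "Suc r"] r by auto
  ultimately show "snd (F ! Suc r) = Suc (snd (F ! r)) \<or>
      snd (F ! Suc r) = snd (F ! r) \<and> block_greater (fst (F ! r)) (fst (F ! Suc r))"
    using diagonal_step[OF sizes, of r] r
    by (auto simp: block_greater_def block_key_def case_prod_beta less_eq_prod_def)
qed

text \<open>Equal multisets have the same sorted list of keys, and injectivity recovers the
  elements. This identifies a filling from its multiset of rows, once with \<open>size_key\<close>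
  and once with \<open>block_key\<close>.\<close>

lemma map_sorted_unique:
  assumes "sorted (map f xs)" "sorted (map f ys)" "mset xs = mset ys" "inj_on f (set ys)"
  shows "xs = ys"
proof -
  have "mset (map f xs) = mset (map f ys)" using assms(3) by simp
  then have "map f xs = map f ys"
    using properties_for_sort[of "map f xs" "map f ys"] assms(1,2) by (simp add: sorted_sort_id)
  moreover have "set xs = set ys" using assms(3) by (rule mset_eq_setD)
  ultimately show ?thesis using assms(4) by (metis inj_on_map_eq_map sup.idem)
qed

section \<open>Column sums\<close>

lemma set_composition_finite:
  assumes "is_set_composition n \<Phi>" "B \<in> set \<Phi>"
  shows "finite B" "B \<noteq> {}"
  using assms unfolding is_set_composition_def
  by (metis Union_upper finite_atLeastAtMost finite_subset, blast)

lemma set_composition_disjoint: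
  assumes "is_set_composition n \<Phi>" "B \<in> set \<Phi>" "C \<in> set \<Phi>" "B \<noteq> C"
  shows "B \<inter> C = {}"
proof -
  obtain r s where rs: "r < length \<Phi>" "\<Phi> ! r = B" "s < length \<Phi>" "\<Phi> ! s = C"
    using assms(2,3) by (auto simp: in_set_conv_nth)
  then have "r < s \<or> s < r" using assms(4) by (metis linorder_neqE_nat)
  then show ?thesis using assms(1) rs unfolding is_set_composition_def by (metis Int_commute)
qed

lemma set_composition_distinct:
  assumes "is_set_composition n \<Phi>"
  shows "distinct \<Phi>"
proof -
  have "\<Phi> ! r \<noteq> \<Phi> ! s" if "r < s" "s < length \<Phi>" for r s
  proof
    assume "\<Phi> ! r = \<Phi> ! s"
    moreover have "\<Phi> ! r \<inter> \<Phi> ! s = {}" using assms that unfolding is_set_composition_def by simp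
    moreover have "\<Phi> ! s \<noteq> {}" using set_composition_finite(2)[OF assms] that by simp
    ultimately show False by simp
  qed
  then show ?thesis unfolding distinct_conv_nth by (metis linorder_neqE_nat)
qed

text \<open>A common minimum would lie in two disjoint blocks. The minimum can therefore stand for
  its block in \<open>block_key\<close>.\<close>

lemma set_composition_inj_Min:
  assumes "is_set_composition n \<Phi>"
  shows "inj_on Min (set \<Phi>)"
proof (rule inj_onI, rule ccontr)
  fix B C assume BC: "B \<in> set \<Phi>" "C \<in> set \<Phi>" "Min B = Min C" "B \<noteq> C"
  then have "Min B \<in> B" "Min C \<in> C" using set_composition_finite[OF assms] by (blast intro: Min_in)+
  then show False using set_composition_disjoint[OF assms BC(1,2,4)] BC(3) by auto
qed

text \<open>The blocks of \<open>col_set F\<close> are unions over the fibres of the column map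
  \<open>g\<close>, hence again disjoint, nonempty and covering. This gives access to the value of
  \<open>rho\<close> at \<open>M_setcomp (col_set F)\<close>.\<close>

lemma set_composition_col_set:
  assumes \<Phi>: "is_set_composition n \<Phi>" and F: "set F = (\<lambda>B. (B, g B)) ` set \<Phi>"
  shows "is_set_composition n (col_set F)"
proof -
  have cols: "set (columns F) = g ` set \<Phi>" "distinct (columns F)"
    by (auto simp: columns_def F image_image)
  have Un: "\<Union>{B. (B, c) \<in> set F} = \<Union>{B \<in> set \<Phi>. g B = c}" for c
    by (rule arg_cong[where f = Union]) (auto simp: F)
  have "\<Union>{B \<in> set \<Phi>. g B = c} \<noteq> {}" if "c \<in> g ` set \<Phi>" for c
    using that set_composition_finite(2)[OF \<Phi>] by auto
  then have 1: "\<forall>B\<in>set (col_set F). B \<noteq> {}" by (auto simp only: col_set_def Un set_map cols(1))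
  have "\<Union>{B \<in> set \<Phi>. g B = c} \<inter> \<Union>{B \<in> set \<Phi>. g B = d} = {}" if "c \<noteq> d" for c d
    using that set_composition_disjoint[OF \<Phi>] by fastforce
  then have 2: "\<forall>r s. r < s \<and> s < length (col_set F) \<longrightarrow> col_set F ! r \<inter> col_set F ! s = {}"
    using cols(2) by (simp add: col_set_def Un distinct_conv_nth)
  have "\<Union>(set (col_set F)) = \<Union>(set \<Phi>)" by (auto simp: col_set_def Un cols(1))
  then have 3: "\<Union>(set (col_set F)) = {1..n}" using \<Phi> by (simp add: is_set_composition_def)
  show ?thesis using 1 2 3 by (simp add: is_set_composition_def)
qed

text \<open>Sizes of disjoint blocks add up. The filling on the right lists its rows in the order of
  \<open>\<Phi>\<close>, whatever the order of \<open>F\<close>, because column sums ignore the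
  order of rows.\<close>

lemma block_sizes_col_set:
  assumes \<Phi>: "is_set_composition n \<Phi>" and F: "set F = (\<lambda>B. (B, g B)) ` set \<Phi>"
  shows "block_sizes (col_set F) = col (map (\<lambda>B. (card B, g B)) \<Phi>)"
proof -
  let ?G = "map (\<lambda>B. (card B, g B)) \<Phi>"
  have "columns F = columns ?G" by (simp add: columns_def F image_image)
  moreover have "card (\<Union>{B. (B, c) \<in> set F}) = (\<Sum>r | r < length ?G \<and> snd (?G ! r) = c. fst (?G ! r))" for c
  proof -
    have "card (\<Union>{B. (B, c) \<in> set F}) = (\<Sum>B | B \<in> set \<Phi> \<and> g B = c. card B)"
    proof -
      have "{B. (B, c) \<in> set F} = {B. B \<in> set \<Phi> \<and> g B = c}" by (auto simp: F)
      then show ?thesis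
        using set_composition_finite(1)[OF \<Phi>] set_composition_disjoint[OF \<Phi>]
        by (simp only:) (rule card_Union_disjoint, auto simp: pairwise_def disjnt_def)
    qed
    also have "\<dots> = (\<Sum>r | r < length \<Phi> \<and> g (\<Phi> ! r) = c. card (\<Phi> ! r))"
    proof (rule sum.reindex_cong[symmetric, OF _ _ refl, symmetric])
      show "inj_on ((!) \<Phi>) {r. r < length \<Phi> \<and> g (\<Phi> ! r) = c}"
        using set_composition_distinct[OF \<Phi>] by (auto simp: inj_on_def nth_eq_iff_index_eq)
      show "{B. B \<in> set \<Phi> \<and> g B = c} = (!) \<Phi> ` {r. r < length \<Phi> \<and> g (\<Phi> ! r) = c}"
        by (auto simp: in_set_conv_nth)
    qed
    also have "\<dots> = (\<Sum>r | r < length ?G \<and> snd (?G ! r) = c. fst (?G ! r))"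
      by (rule sum.cong) auto
    finally show ?thesis .
  qed
  ultimately show ?thesis by (simp add: block_sizes_def col_set_def col_def)
qed

lemma rho_sum: "rho (\<Sum>x\<in>A. f x) = (\<Sum>x\<in>A. rho (f x))"
proof -
  interpret rho: Vector_Spaces.linear series_scale series_scale rho by (rule linear_rho)
  show ?thesis by (rule rho.sum)
qed

section \<open>The action on set compositions\<close>

text \<open>The number \<open>r\<close> that \<open>act\<close> gives to position \<open>p\<close>,
  counted from 1. Taken from the sizes alone, it is shared by all rearrangements with the same size
  sequence.\<close>

definition size_rank :: "nat list \<Rightarrow> nat \<Rightarrow> nat" where
  "size_rank xs p = card {q. q \<le> p \<and> xs ! q = xs ! p}"

text \<open>Cutting the list at \<open>p\<close> shows that the rank is one more than the number of
  earlier blocks of this size.\<close>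

lemma nth_filter_size_rank:
  assumes "p < length \<Phi>"
  shows "1 \<le> size_rank (map card \<Phi>) p"
    and "size_rank (map card \<Phi>) p \<le> length (filter (\<lambda>B. card B = card (\<Phi> ! p)) \<Phi>)"
    and "filter (\<lambda>B. card B = card (\<Phi> ! p)) \<Phi> ! (size_rank (map card \<Phi>) p - 1) = \<Phi> ! p"
proof -
  let ?P = "\<lambda>B. card B = card (\<Phi> ! p)"
  have "{q. q \<le> p \<and> map card \<Phi> ! q = map card \<Phi> ! p} =
      insert p {q. q < length (take p \<Phi>) \<and> ?P (take p \<Phi> ! q)}"
    using assms by auto
  then have rank: "size_rank (map card \<Phi>) p = Suc (length (filter ?P (take p \<Phi>)))"
    by (simp add: size_rank_def length_filter_conv_card)
  have "filter ?P \<Phi> = filter ?P (take p \<Phi>) @ \<Phi> ! p # filter ?P (drop (Suc p) \<Phi>)"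
    by (subst id_take_nth_drop[OF assms]) simp
  then show "1 \<le> size_rank (map card \<Phi>) p" "size_rank (map card \<Phi>) p \<le> length (filter ?P \<Phi>)"
    "filter ?P \<Phi> ! (size_rank (map card \<Phi>) p - 1) = \<Phi> ! p"
    by (simp_all add: rank)
qed

text \<open>The block numbered \<open>r\<close> among those of size \<open>i\<close> sits at some
  position \<open>p\<close>; as blocks are distinct, the rank of \<open>p\<close> can only be
  \<open>r\<close>.\<close>

lemma ex_size_rank:
  assumes "distinct \<Phi>" "1 \<le> r" "r \<le> length (filter (\<lambda>B. card B = i) \<Phi>)"
  shows "\<exists>p<length \<Phi>. card (\<Phi> ! p) = i \<and> size_rank (map card \<Phi>) p = r"
proof -
  let ?C = "filter (\<lambda>B. card B = i) \<Phi>"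
  have r: "r - 1 < length ?C" using assms by simp
  then have "?C ! (r - 1) \<in> set ?C" by (rule nth_mem)
  then obtain p where p: "p < length \<Phi>" "\<Phi> ! p = ?C ! (r - 1)" "card (\<Phi> ! p) = i"
    by (auto simp: in_set_conv_nth[of _ \<Phi>])
  have "?C ! (size_rank (map card \<Phi>) p - 1) = ?C ! (r - 1)" "1 \<le> size_rank (map card \<Phi>) p"
    "size_rank (map card \<Phi>) p - 1 < length ?C"
    using nth_filter_size_rank[OF p(1)] p(2,3) by auto
  then have "size_rank (map card \<Phi>) p - 1 = r - 1"
    using assms(1) r by (simp add: nth_eq_iff_index_eq)
  then show ?thesis using p assms(2) \<open>1 \<le> size_rank (map card \<Phi>) p\<close>
    by (metis le_add_diff_inverse)
qed

lemma nth_act: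
  assumes "p < length \<Phi>"
  shows "act \<sigma> \<Phi> ! p = filter (\<lambda>B. card B = card (\<Phi> ! p)) \<Phi> !
    (inv (\<sigma> (card (\<Phi> ! p))) (size_rank (map card \<Phi>) p) - 1)"
proof -
  have "{q. q \<le> p \<and> card (\<Phi> ! q) = card (\<Phi> ! p)} =
      {q. q \<le> p \<and> map card \<Phi> ! q = map card \<Phi> ! p}"
    using assms by auto
  then show ?thesis using assms by (simp add: act_def Let_def size_rank_def)
qed

lemma length_act [simp]: "length (act \<sigma> \<Phi>) = length \<Phi>"
  by (simp add: act_def)

section \<open>Matching the action with rearrangements\<close>

lemma ex_shifted_permutation:
  fixes xs ys :: "'a list"
  assumes "distinct xs" "mset ys = mset xs"
  shows "\<exists>q. q permutes {1..length xs} \<and> (\<forall>r\<in>{1..length xs}. xs ! (q r - 1) = ys ! (r - 1))"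
proof -
  obtain p where p: "p permutes {..<length xs}" "permute_list p xs = ys"
    using mset_eq_permutation[OF assms(2)] by blast
  \<comment> \<open>Conjugation by the shift turns list positions from 0 into numbers from 1, as
    used by \<open>act\<close>; 0 lies outside the range and is fixed.\<close>
  define q where "q r = (if r = 0 then 0 else Suc (p (r - 1)))" for r
  have "q permutes {1..length xs}"
  proof (rule bij_imp_permutes)
    have "p ` {..<length xs} = {..<length xs}" using p(1) by (rule permutes_image)
    moreover have "q ` {1..length xs} = Suc ` p ` {..<length xs}"
    proof -
      have "{1..length xs} = Suc ` {..<length xs}" by (simp add: image_Suc_lessThan)
      then show ?thesis by (simp only: image_image) (simp add: q_def)
    qed
    ultimately have "q ` {1..length xs} = {1..length xs}" by (simp add: image_Suc_lessThan)
    then show "bij_betw q {1..length xs} {1..length xs}"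
      by (simp add: bij_betw_def eq_card_imp_inj_on)
    show "q r = r" if "r \<notin> {1..length xs}" for r
      using that permutes_not_in[OF p(1), of "r - 1"] by (auto simp: q_def)
  qed
  moreover have "xs ! (q r - 1) = ys ! (r - 1)" if "r \<in> {1..length xs}" for r
    using that p by (auto simp: q_def permute_list_nth)
  ultimately show ?thesis by blast
qed

text \<open>Each size can be treated separately. Every number in \<open>{1..m i}\<close> is the rank
  of some position, so the result determines \<open>inv (\<sigma> i)\<close>; conversely, comparing
  the sublists of blocks of size \<open>i\<close> yields the permutation needed.\<close>

lemma bij_betw_act:
  assumes dist: "distinct \<Phi>"
    and m: "\<And>i. i \<in> {1..j} \<Longrightarrow> length (filter (\<lambda>B. card B = i) \<Phi>) = m i"
    and sizes: "card ` set \<Phi> \<subseteq> {1..j}"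
  shows "bij_betw (\<lambda>\<sigma>. act \<sigma> \<Phi>) (\<Pi>\<^sub>E i\<in>{1..j}. {p. p permutes {1..m i}})
    {\<Psi>. map card \<Psi> = map card \<Phi> \<and> mset \<Psi> = mset \<Phi>}"
proof -
  define C where "C i = filter (\<lambda>B. card B = i) \<Phi>" for i
  define rk where "rk = size_rank (map card \<Phi>)"
  have C: "distinct (C i)" for i using dist by (simp add: C_def)
  have lenC: "length (C i) = m i" if "i \<in> {1..j}" for i using m[OF that] by (simp add: C_def)
  have size: "card (\<Phi> ! p) \<in> {1..j}" if "p < length \<Phi>" for p using sizes nth_mem[OF that] by blast
  have rk: "rk p \<in> {1..m (card (\<Phi> ! p))}" "C (card (\<Phi> ! p)) ! (rk p - 1) = \<Phi> ! p"
    if "p < length \<Phi>" for p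
    using nth_filter_size_rank[OF that] m[OF size[OF that]] by (auto simp: rk_def C_def)
  have ex_rk: "\<exists>p<length \<Phi>. card (\<Phi> ! p) = i \<and> rk p = r" if "i \<in> {1..j}" "r \<in> {1..m i}" for i r
    using ex_size_rank[OF dist, of r i] m[OF that(1)] that(2) by (auto simp: rk_def)
  have act: "act \<sigma> \<Phi> ! p = C (card (\<Phi> ! p)) ! (inv (\<sigma> (card (\<Phi> ! p))) (rk p) - 1)"
    if "p < length \<Phi>" for \<sigma> p
    using nth_act[OF that] by (simp add: rk_def C_def)
  have inv_mem: "inv (\<sigma> i) r \<in> {1..m i}"
    if "\<sigma> \<in> (\<Pi>\<^sub>E i\<in>{1..j}. {p. p permutes {1..m i}})" "i \<in> {1..j}" "r \<in> {1..m i}" for \<sigma> i r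
  proof -
    have "\<sigma> i permutes {1..m i}" using PiE_mem[OF that(1,2)] by simp
    then show ?thesis using that(3) by (simp only: permutes_in_image[OF permutes_inv])
  qed
  have C_eq: "r = s" if "C i ! (r - 1) = C i ! (s - 1)" "i \<in> {1..j}" "r \<in> {1..m i}" "s \<in> {1..m i}"
    for i r s
  proof -
    have "r - 1 < length (C i)" "s - 1 < length (C i)" using that(3,4) lenC[OF that(2)] by auto
    then have "r - 1 = s - 1" using that(1) C by (simp add: nth_eq_iff_index_eq)
    then show ?thesis using that(3,4) by auto
  qed
  show ?thesis
  proof (rule bij_betw_imageI)
    show "inj_on (\<lambda>\<sigma>. act \<sigma> \<Phi>) (\<Pi>\<^sub>E i\<in>{1..j}. {p. p permutes {1..m i}})"
    proof (rule inj_onI)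
      fix \<sigma> \<sigma>' assume \<sigma>: "\<sigma> \<in> (\<Pi>\<^sub>E i\<in>{1..j}. {p. p permutes {1..m i}})"
        and \<sigma>': "\<sigma>' \<in> (\<Pi>\<^sub>E i\<in>{1..j}. {p. p permutes {1..m i}})"
        and eq: "act \<sigma> \<Phi> = act \<sigma>' \<Phi>"
      show "\<sigma> = \<sigma>'"
      proof (rule PiE_ext[OF \<sigma> \<sigma>'])
        fix i assume i: "i \<in> {1..j}"
        have perm: "\<sigma> i permutes {1..m i}" "\<sigma>' i permutes {1..m i}"
          using PiE_mem[OF \<sigma> i] PiE_mem[OF \<sigma>' i] by simp_all
        have "inv (\<sigma> i) r = inv (\<sigma>' i) r" for r
        proof (cases "r \<in> {1..m i}")
          case True
          obtain p where p: "p < length \<Phi>" "card (\<Phi> ! p) = i" "rk p = r" using ex_rk[OF i True] by blast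
          have "C i ! (inv (\<sigma> i) r - 1) = C i ! (inv (\<sigma>' i) r - 1)"
            using act[OF p(1), of \<sigma>] act[OF p(1), of \<sigma>'] eq p(2,3) by simp
          then show ?thesis by (rule C_eq[OF _ i inv_mem[OF \<sigma> i True] inv_mem[OF \<sigma>' i True]])
        next
          case False
          then show ?thesis using perm permutes_inv permutes_not_in by metis
        qed
        then have "inv (\<sigma> i) = inv (\<sigma>' i)" by blast
        then show "\<sigma> i = \<sigma>' i" using perm by (metis permutes_inv_inv)
      qed
    qed
    show "(\<lambda>\<sigma>. act \<sigma> \<Phi>) ` (\<Pi>\<^sub>E i\<in>{1..j}. {p. p permutes {1..m i}}) =
        {\<Psi>. map card \<Psi> = map card \<Phi> \<and> mset \<Psi> = mset \<Phi>}"
    proof (intro equalityI subsetI)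
      fix \<Psi> assume "\<Psi> \<in> (\<lambda>\<sigma>. act \<sigma> \<Phi>) ` (\<Pi>\<^sub>E i\<in>{1..j}. {p. p permutes {1..m i}})"
      then obtain \<sigma> where \<sigma>: "\<sigma> \<in> (\<Pi>\<^sub>E i\<in>{1..j}. {p. p permutes {1..m i}})" "\<Psi> = act \<sigma> \<Phi>" by blast
      have mem: "inv (\<sigma> (card (\<Phi> ! p))) (rk p) \<in> {1..m (card (\<Phi> ! p))}" if "p < length \<Phi>" for p
        using inv_mem[OF \<sigma>(1) size[OF that] rk(1)[OF that]] .
      have "\<Psi> ! p \<in> set (C (card (\<Phi> ! p)))" if "p < length \<Phi>" for p
        unfolding \<sigma>(2) act[OF that]
        by (rule nth_mem) (use mem[OF that] lenC[OF size[OF that]] in auto)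
      then have \<Psi>: "card (\<Psi> ! p) = card (\<Phi> ! p)" "\<Psi> ! p \<in> set \<Phi>" if "p < length \<Phi>" for p
        using that by (auto simp: C_def)
      have len: "length \<Psi> = length \<Phi>" by (simp add: \<sigma>(2))
      have "distinct \<Psi>"
        unfolding distinct_conv_nth len
      proof (intro allI impI notI)
        fix p q assume pq: "p < length \<Phi>" "q < length \<Phi>" "p \<noteq> q" "\<Psi> ! p = \<Psi> ! q"
        \<comment> \<open>Equal blocks have equal size, so they come from the same
          \<open>C i\<close> with the same number; undoing the permutation gives equal
          ranks.\<close>
        then have i: "card (\<Phi> ! p) = card (\<Phi> ! q)" using \<Psi>(1) by metis
        have perm: "\<sigma> (card (\<Phi> ! q)) permutes {1..m (card (\<Phi> ! q))}"
          using PiE_mem[OF \<sigma>(1) size[OF pq(2)]] by simp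
        have "inv (\<sigma> (card (\<Phi> ! q))) (rk p) = inv (\<sigma> (card (\<Phi> ! q))) (rk q)"
          using pq(4) act[OF pq(1), of \<sigma>] act[OF pq(2), of \<sigma>] mem[OF pq(1)]
          unfolding \<sigma>(2) i by (intro C_eq[OF _ size[OF pq(2)] _ mem[OF pq(2)]]) simp_all
        then have "rk p = rk q" using permutes_inj[OF permutes_inv[OF perm]] by (metis injD)
        then have "\<Phi> ! p = \<Phi> ! q" using rk(2)[OF pq(1)] rk(2)[OF pq(2)] i by simp
        then show False using dist pq by (simp add: nth_eq_iff_index_eq)
      qed
      \<comment> \<open>Inclusion suffices, both lists being free of repetitions and equally
        long.\<close>
      moreover have "set \<Psi> = set \<Phi>"
      proof (rule card_subset_eq)
        show "set \<Psi> \<subseteq> set \<Phi>" using \<Psi>(2) len by (auto simp: in_set_conv_nth[of _ \<Psi>])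
        show "card (set \<Psi>) = card (set \<Phi>)"
          using \<open>distinct \<Psi>\<close> dist len by (simp add: distinct_card)
      qed simp
      ultimately have "mset \<Psi> = mset \<Phi>" using dist by (simp add: set_eq_iff_mset_eq_distinct)
      moreover have "map card \<Psi> = map card \<Phi>" by (rule nth_equalityI) (simp_all add: len \<Psi>(1))
      ultimately show "\<Psi> \<in> {\<Psi>. map card \<Psi> = map card \<Phi> \<and> mset \<Psi> = mset \<Phi>}" by simp
    next
      fix \<Psi> assume "\<Psi> \<in> {\<Psi>. map card \<Psi> = map card \<Phi> \<and> mset \<Psi> = mset \<Phi>}"
      then have \<Psi>: "map card \<Psi> = map card \<Phi>" "mset \<Psi> = mset \<Phi>" by auto
      define D where "D i = filter (\<lambda>B. card B = i) \<Psi>" for i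
      have len: "length \<Psi> = length \<Phi>" using \<Psi>(2) by (metis size_mset)
      have "mset (D i) = mset (C i)" for i using \<Psi>(2) by (simp add: C_def D_def)
      then have "\<forall>i. \<exists>q. q permutes {1..length (C i)} \<and> (\<forall>r\<in>{1..length (C i)}. C i ! (q r - 1) = D i ! (r - 1))"
        using ex_shifted_permutation[OF C] by blast
      then obtain q where q: "\<And>i. q i permutes {1..length (C i)}"
        "\<And>i r. r \<in> {1..length (C i)} \<Longrightarrow> C i ! (q i r - 1) = D i ! (r - 1)" by metis
      \<comment> \<open>The inverse compensates for the one in \<open>act\<close>; the restriction
        to \<open>{1..j}\<close> meets the extensionality of the product.\<close>
      define \<sigma> where "\<sigma> = (\<lambda>i\<in>{1..j}. inv (q i))"
      have \<sigma>: "\<sigma> \<in> (\<Pi>\<^sub>E i\<in>{1..j}. {p. p permutes {1..m i}})"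
      proof (rule PiE_I)
        show "\<sigma> i \<in> {p. p permutes {1..m i}}" if "i \<in> {1..j}" for i
          using permutes_inv[OF q(1)[of i]] that by (simp add: \<sigma>_def lenC[OF that])
      qed (auto simp: \<sigma>_def)
      have "act \<sigma> \<Phi> = \<Psi>"
      proof (rule nth_equalityI)
        fix p assume "p < length (act \<sigma> \<Phi>)"
        then have p: "p < length \<Phi>" by simp
        let ?i = "card (\<Phi> ! p)"
        have i: "card (\<Psi> ! p) = ?i" using \<Psi>(1) p len by (metis nth_map)
        have "inv (\<sigma> ?i) = q ?i" using size[OF p] permutes_inv_inv[OF q(1)] by (simp add: \<sigma>_def)
        then have "act \<sigma> \<Phi> ! p = C ?i ! (q ?i (rk p) - 1)" using act[OF p] by simp
        also have "\<dots> = D ?i ! (rk p - 1)" using rk(1)[OF p] lenC[OF size[OF p]] by (intro q(2)) simp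
        also have "\<dots> = \<Psi> ! p"
          using nth_filter_size_rank(3)[of p \<Psi>] p len i by (simp add: D_def rk_def \<Psi>(1))
        finally show "act \<sigma> \<Phi> ! p = \<Psi> ! p" .
      qed (simp add: len)
      then show "\<Psi> \<in> (\<lambda>\<sigma>. act \<sigma> \<Phi>) ` (\<Pi>\<^sub>E i\<in>{1..j}. {p. p permutes {1..m i}})" using \<sigma> by blast
    qed
  qed
qed

section \<open>Attaching columns to blocks\<close>

text \<open>Reads the multiplicities off the sorted composition; the value 0 outside the range later
  bounds the block sizes by \<open>j\<close>.\<close>

lemma count_concat_replicate:
  "length (filter (\<lambda>a. a = i) (concat (map (\<lambda>i. replicate (m i) i) [1..<Suc j]))) =
    (if i \<in> {1..j} then m i else 0)"
  by (induction j) (auto simp: le_Suc_eq)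

text \<open>Both sides become sums over pairs: \<open>F\<close> in \<open>SD\<close> with a
  rearrangement \<open>G\<close>, and \<open>\<Psi>\<close> with a filling in
  \<open>LDD \<Psi>\<close>. The maps \<open>toF\<close> and \<open>toG\<close> exchange the second
  components; the first ones are recovered as \<open>sizes (toF G)\<close> and
  \<open>map fst (toF G)\<close>.\<close>

lemma P_comp_eq_sum_rearrangements:
  assumes \<Phi>: "is_set_composition n \<Phi>"
  defines "A \<equiv> {\<Psi>. map card \<Psi> = map card \<Phi> \<and> mset \<Psi> = mset \<Phi>}"
  shows "P_comp (block_sizes \<Phi>) = (\<Sum>\<Psi>\<in>A. rho (P_setcomp \<Psi>))"
proof -
  let ?\<alpha> = "block_sizes \<Phi>"
  define R where "R F = {G. map fst G = ?\<alpha> \<and> mset G = mset F}" for F :: "nat filling"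
  define sizes where "sizes = map (map_prod card id :: nat set \<times> nat \<Rightarrow> nat \<times> nat)"
  \<comment> \<open>Applied only where the blocks of \<open>F\<close> are exactly those of
    \<open>\<Phi>\<close>, so that \<open>the\<close> meets a defined value.\<close>
  define place where "place F = (\<lambda>B. the (map_of F B))" for F :: "nat set filling"
  define toG where "toG F = map (\<lambda>B. (card B, place F B)) \<Phi>" for F
  define toF where "toF G = sort_key block_key (zip \<Phi> (map snd G))" for G :: "nat filling"
  have dist: "distinct \<Phi>" by (rule set_composition_distinct[OF \<Phi>])
  have R: "(\<lambda>\<tau>. permute_rows \<tau> F) ` row_perms F = R F" if "F \<in> SD ?\<alpha>" for F
    using that by (simp add: permute_rows_image R_def SD_def)
  have finite_A: "finite A"
  proof (rule finite_subset)
    show "A \<subseteq> {\<Psi>. set \<Psi> \<subseteq> set \<Phi> \<and> length \<Psi> = length \<Phi>}"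
      by (auto simp: A_def dest: mset_eq_setD mset_eq_length)
  qed (rule finite_lists_length_eq, simp)
  have inj_key: "inj_on block_key (set F)" if "fst ` set F \<subseteq> set \<Phi>" for F
  proof (rule inj_onI)
    fix x y assume xy: "x \<in> set F" "y \<in> set F" "block_key x = block_key y"
    then have "fst x \<in> set \<Phi>" "fst y \<in> set \<Phi>" using that by auto
    then have "fst x = fst y"
      using xy(3) set_composition_inj_Min[OF \<Phi>]
      by (auto simp: block_key_def case_prod_beta dest: inj_onD)
    then show "x = y" using xy(3) by (simp add: block_key_def case_prod_beta prod_eq_iff)
  qed
  have LDD: "map fst F = \<Psi>" "diagonal block_greater F" "distinct (map fst F)"
    "mset F = image_mset (\<lambda>B. (B, place F B)) (mset \<Phi>)"
    if "\<Psi> \<in> A" "F \<in> LDD \<Psi>" for \<Psi> F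
  proof -
    show F: "map fst F = \<Psi>" "diagonal block_greater F" using that(2) by (auto simp: LDD_def)
    have mset: "mset (map fst F) = mset \<Phi>" using that(1) F(1) by (simp add: A_def)
    then show d: "distinct (map fst F)" using dist by (metis mset_eq_imp_distinct_iff)
    have "(fst x, place F (fst x)) = x" if "x \<in> set F" for x
      using that map_of_eq_Some_iff[OF d, of "fst x" "snd x"] by (simp add: place_def)
    then have "F = map (\<lambda>B. (B, place F B)) (map fst F)" by (simp add: map_idI comp_def)
    then have "mset F = image_mset (\<lambda>B. (B, place F B)) (mset (map fst F))" by (metis mset_map)
    then show "mset F = image_mset (\<lambda>B. (B, place F B)) (mset \<Phi>)" unfolding mset .
  qed
  have zip_sizes: "sizes (zip \<Phi> (map snd G)) = G" if "map fst G = ?\<alpha>" for G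
  proof (rule nth_equalityI)
    have len: "length G = length \<Phi>" using that by (metis block_sizes_def length_map)
    then show "length (sizes (zip \<Phi> (map snd G))) = length G" by (simp add: sizes_def)
    fix r assume "r < length (sizes (zip \<Phi> (map snd G)))"
    then have r: "r < length \<Phi>" "r < length G" using len by (simp_all add: sizes_def)
    then have "fst (G ! r) = card (\<Phi> ! r)" using that by (metis block_sizes_def nth_map)
    then show "sizes (zip \<Phi> (map snd G)) ! r = G ! r" using r by (simp add: sizes_def prod_eq_iff)
  qed
  have toF: "toF G \<in> LDD (map fst (toF G))" "map fst (toF G) \<in> A" "sizes (toF G) = F" "toG (toF G) = G"
    if F: "F \<in> SD ?\<alpha>" and G: "G \<in> R F" for F G
  proof -
    let ?Z = "zip \<Phi> (map snd G)"
    have G': "map fst G = ?\<alpha>" "mset G = mset F" using G by (auto simp: R_def)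
    have len: "length G = length \<Phi>" using G'(1) by (metis block_sizes_def length_map)
    have mset: "mset (toF G) = mset ?Z" by (simp add: toF_def)
    have fstZ: "map fst ?Z = \<Phi>" by (simp add: len)
    have fst: "mset (map fst (toF G)) = mset \<Phi>" by (metis fstZ mset mset_map)
    have sorted: "sorted (map block_key (toF G))" by (simp add: toF_def)
    \<comment> \<open>Sorting by \<open>block_key\<close> also sorts the sizes by
      \<open>size_key\<close>. \<open>F\<close> is sorted in this way too and has the same rows as
      \<open>G\<close>, so the two coincide.\<close>
    show eqF: "sizes (toF G) = F"
    proof (rule map_sorted_unique[where f = size_key])
      show "sorted (map size_key (sizes (toF G)))"
        unfolding sizes_def by (rule sorted_size_key_of_block_key[OF sorted])
      show "sorted (map size_key F)" using F by (intro sorted_size_key) (simp add: SD_def)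
      have "mset (sizes (toF G)) = mset (sizes ?Z)" by (simp add: sizes_def mset)
      then show "mset (sizes (toF G)) = mset F" by (simp add: zip_sizes[OF G'(1)] G'(2))
      show "inj_on size_key (set F)" using inj_size_key by (rule inj_on_subset) simp
    qed
    have "map card (map fst (toF G)) = map fst F" unfolding eqF[symmetric] by (simp add: sizes_def)
    then show "map fst (toF G) \<in> A" using F fst by (simp add: A_def SD_def block_sizes_def)
    have d: "distinct (map fst (toF G))" using fst dist by (metis mset_eq_imp_distinct_iff)
    moreover have "set (map fst (toF G)) = set \<Phi>" using fst by (rule mset_eq_setD)
    ultimately have "distinct (map Min (map fst (toF G)))"
      using set_composition_inj_Min[OF \<Phi>] by (simp only: distinct_map)
    \<comment> \<open>Diagonality of the sizes is inherited from \<open>F\<close>; the sort order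
      and the distinct minima refine it to blocks.\<close>
    then have "diagonal block_greater (toF G)"
      using F eqF sorted by (intro diagonal_of_sorted_block_key) (simp_all add: SD_def sizes_def)
    then show "toF G \<in> LDD (map fst (toF G))" by (simp add: LDD_def)
    show "toG (toF G) = G"
    proof (rule nth_equalityI)
      fix r assume "r < length (toG (toF G))"
      then have r: "r < length \<Phi>" by (simp add: toG_def)
      then have "(\<Phi> ! r, snd (G ! r)) \<in> set ?Z" using len by (auto simp: in_set_zip)
      then have "(\<Phi> ! r, snd (G ! r)) \<in> set (toF G)" using mset_eq_setD[OF mset] by simp
      then have "place (toF G) (\<Phi> ! r) = snd (G ! r)" using d by (simp add: place_def)
      moreover have "fst (G ! r) = card (\<Phi> ! r)" using G'(1) r len by (metis block_sizes_def nth_map)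
      ultimately show "toG (toF G) ! r = G ! r" using r by (simp add: toG_def prod_eq_iff)
    qed (simp add: toG_def len)
  qed
  have toG: "sizes F \<in> SD ?\<alpha>" "toG F \<in> R (sizes F)" "toF (toG F) = F"
    "rho (M_setcomp (col_set F)) = M_comp (col (toG F))"
    if \<Psi>: "\<Psi> \<in> A" and F: "F \<in> LDD \<Psi>" for \<Psi> F
  proof -
    note L = LDD[OF \<Psi> F]
    have d: "diagonal (\<ge>) (sizes F)" unfolding sizes_def by (rule diagonal_sizes[OF L(2)])
    have "map fst (sizes F) = map card (map fst F)" by (simp add: sizes_def)
    then have "map fst (sizes F) = ?\<alpha>" using \<Psi> L(1) by (simp add: A_def block_sizes_def)
    then show "sizes F \<in> SD ?\<alpha>" using d diagonal_columns_interval[OF d] by (simp add: SD_def)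
    have "mset (toG F) = image_mset (map_prod card id) (image_mset (\<lambda>B. (B, place F B)) (mset \<Phi>))"
      by (simp add: toG_def multiset.map_comp comp_def)
    then have "mset (toG F) = mset (sizes F)" by (simp add: sizes_def L(4))
    then show "toG F \<in> R (sizes F)" by (simp add: R_def toG_def block_sizes_def)
    \<comment> \<open>Reading \<open>toG F\<close> against \<open>\<Phi>\<close> returns the rows of
      \<open>F\<close> in the order of \<open>\<Phi>\<close>; sorting them restores
      \<open>F\<close>, itself sorted by \<open>block_key\<close>.\<close>
    have Z: "zip \<Phi> (map snd (toG F)) = map (\<lambda>B. (B, place F B)) \<Phi>"
      by (simp add: toG_def zip_map2 zip_same_conv_map)
    have set: "set F = (\<lambda>B. (B, place F B)) ` set \<Phi>" using L(4) by (metis set_image_mset set_mset_mset)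
    show "toF (toG F) = F"
    proof (rule map_sorted_unique[where f = block_key])
      show "sorted (map block_key F)" by (rule sorted_block_key[OF L(2)])
      show "mset (toF (toG F)) = mset F" by (simp add: toF_def Z L(4))
      show "inj_on block_key (set F)" by (rule inj_key) (auto simp: set)
    qed (simp add: toF_def)
    show "rho (M_setcomp (col_set F)) = M_comp (col (toG F))"
      using rho_M_setcomp[OF set_composition_col_set[OF \<Phi> set]] block_sizes_col_set[OF \<Phi> set]
      by (simp add: toG_def)
  qed
  have rho_toF: "rho (M_setcomp (col_set (toF G))) = M_comp (col G)" if "F \<in> SD ?\<alpha>" "G \<in> R F" for F G
    using toG(4)[OF toF(2,1)[OF that]] toF(4)[OF that] by simp
  have "P_comp ?\<alpha> = (\<Sum>F\<in>SD ?\<alpha>. \<Sum>G\<in>R F. M_comp (col G))"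
    unfolding P_comp_def by (rule sum.cong) (simp_all add: R)
  also have "\<dots> = (\<Sum>(F, G)\<in>Sigma (SD ?\<alpha>) R. M_comp (col G))"
    using finite_row_fillings by (intro sum.Sigma finite_SD) (auto simp flip: R)
  also have "\<dots> = (\<Sum>(\<Psi>, F)\<in>Sigma A LDD. rho (M_setcomp (col_set F)))"
    by (rule sum.reindex_bij_witness[where i = "\<lambda>(\<Psi>, F). (sizes F, toG F)"
          and j = "\<lambda>(F, G). (map fst (toF G), toF G)"])
      (auto simp: toF toG LDD rho_toF)
  also have "\<dots> = (\<Sum>\<Psi>\<in>A. \<Sum>F\<in>LDD \<Psi>. rho (M_setcomp (col_set F)))"
    by (intro sum.Sigma[symmetric] finite_A) (simp add: finite_LDD)
  also have "\<dots> = (\<Sum>\<Psi>\<in>A. rho (P_setcomp \<Psi>))" by (simp add: P_setcomp_def rho_sum)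
  finally show ?thesis .
qed

theorem theorem4p7:
  fixes \<alpha> :: "nat list" and m :: "nat \<Rightarrow> nat" and j n :: nat and \<Phi> :: "nat set list"
  assumes "is_composition \<alpha>"
    and "sort \<alpha> = concat (map (\<lambda>i. replicate (m i) i) [1..<Suc j])"
    and "is_set_composition n \<Phi>"
    and "block_sizes \<Phi> = \<alpha>"
  shows "P_comp \<alpha> =
    (\<Sum>\<sigma> \<in> (\<Pi>\<^sub>E i\<in>{1..j}. {p. p permutes {1..m i}}). rho (P_setcomp (act \<sigma> \<Phi>)))"
proof -
  have count: "length (filter (\<lambda>a. a = i) \<alpha>) = (if i \<in> {1..j} then m i else 0)" for i
  proof -
    have "length (filter (\<lambda>a. a = i) \<alpha>) = length (filter (\<lambda>a. a = i) (sort \<alpha>))"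
      by (metis mset_filter mset_sort size_mset)
    then show ?thesis unfolding assms(2) count_concat_replicate .
  qed
  have \<alpha>: "\<alpha> = map card \<Phi>" using assms(4) by (simp add: block_sizes_def)
  have "length (filter (\<lambda>B. card B = i) \<Phi>) = m i" if "i \<in> {1..j}" for i
    using count[of i] that by (simp add: \<alpha> filter_map comp_def)
  moreover have "card ` set \<Phi> \<subseteq> {1..j}"
  proof
    fix i assume "i \<in> card ` set \<Phi>"
    \<comment> \<open>A size that occurs has positive multiplicity in \<open>\<alpha>\<close>,
      whereas numbers outside \<open>{1..j}\<close> have multiplicity 0.\<close>
    then have "filter (\<lambda>a. a = i) \<alpha> \<noteq> []" by (auto simp: \<alpha> filter_empty_conv)
    then show "i \<in> {1..j}" using count[of i] by (auto split: if_splits)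
  qed
  ultimately have bij: "bij_betw (\<lambda>\<sigma>. act \<sigma> \<Phi>) (\<Pi>\<^sub>E i\<in>{1..j}. {p. p permutes {1..m i}})
      {\<Psi>. map card \<Psi> = map card \<Phi> \<and> mset \<Psi> = mset \<Phi>}"
    by (rule bij_betw_act[OF set_composition_distinct[OF assms(3)]])
  show ?thesis
    unfolding sum.reindex_bij_betw[OF bij, of "\<lambda>\<Psi>. rho (P_setcomp \<Psi>)"]
    using P_comp_eq_sum_rearrangements[OF assms(3)] unfolding assms(4) .
qed

end
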